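(* Let $\mathbb{E}$ be an embedding of the graph $G$ with genus $g_{min}(G)$, and let $v=(s_v,\pi_v)_{q_v}$ be a vertex of $G$, with $D_v=s_v\circ\pi_v^{-1}$. Then $$\ell(\lambda(D_v))+q_v=deg(v)+1.$$
   Context: Graphs are finite and connected with at least one edge, loops and multiple edges allowed. An embedding is a 2-cell embedding on a closed orientable surface. Permutations are composed right to left, and fixed points count as cycles. An embedding $\mathbb{E}$ of $G$ with $e$ edges is encoded by a triple $(\alpha,\beta,\gamma)$ of permutations of the set $[2e]$ of half edges (each edge consists of two half edges): $\alpha$ is the fixed-point-free involution pairing the two half edges of each edge; the cycles of $\beta$ are the vertices, each cycle listing the half edges incident to that vertex in counterclockwise cyclic order; $\gamma=\alpha\beta$, and its cycles are the faces. Write $s=\gamma$, $\pi=\beta$. The genus $g=g(\mathbb{E})$ is given by $(\#\text{vertices})-(\#\text{edges})+(\#\text{faces})=2-2g$; $g_{min}(G)$ is the minimum genus of an embedding of $G$. For a vertex $v$, $H(v)$ is the set of half edges incident to $v$ and $deg(v)=|H(v)|$. A face is incident to $v$ if the corresponding cycle of $s$ contains an element of $H(v)$; $q_v$ is the number of faces incident to $v$. The pair $(s_v,\pi_v)_{q_v}$ consists of permutations of $H(v)$: $s_v$ (with $q_v$ cycles) is obtained from the $q_v$ cycles of $s$ incident to $v$ by deleting all elements not in $H(v)$, and $\pi_v$ is the restriction of $\pi$ to $H(v)$ (a single cycle). $\lambda(D_v)$ is the cycle-type of $D_v$ and $\ell(\lambda(D_v))$ its number of parts, i.e. the number of cycles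 of $D_v$ as a permutation of $H(v)$. *)

theory Defs
  imports Complex_Main "HOL-Library.Uprod" "HOL-Library.Multiset" "HOL-Combinatorics.Orbits"
begin

section \<open>Multigraphs\<close>

text \<open>Loops are edges with ends \<open>Upair u u\<close>; parallel edges are distinct edges with equal ends.\<close>

record ('v, 'e) multigraph =
  verts :: "'v set"
  edges :: "'e set"
  ends :: "'e \<Rightarrow> 'v uprod"

definition adjacency :: "('v, 'e) multigraph \<Rightarrow> ('v \<times> 'v) set" where
  "adjacency G = {(u, w). \<exists>e \<in> edges G. ends G e = Upair u w}"

definition finite_connected_multigraph :: "('v, 'e) multigraph \<Rightarrow> bool" where
  "finite_connected_multigraph G \<longleftrightarrow>
     finite (verts G) \<and> finite (edges G) \<and> edges G \<noteq> {} \<and>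
     (\<forall>e \<in> edges G. set_uprod (ends G e) \<subseteq> verts G) \<and>
     (\<forall>u \<in> verts G. \<forall>w \<in> verts G. (u, w) \<in> (adjacency G)\<^sup>*)"


section \<open>Cycles of permutations\<close>

text \<open>The set of cycles of a permutation \<open>p\<close> of \<open>A\<close>, each given by its underlying set.
  A fixed point \<open>x \<in> A\<close> contributes the cycle \<open>{x}\<close>.\<close>

definition cycles_of :: "('a \<Rightarrow> 'a) \<Rightarrow> 'a set \<Rightarrow> 'a set set" where
  "cycles_of p A = orbit p ` A"

definition cycle_type :: "('a \<Rightarrow> 'a) \<Rightarrow> 'a set \<Rightarrow> nat multiset" where
  "cycle_type p A = image_mset card (mset_set (cycles_of p A))"

text \<open>Deleting from the cycles of \<open>p\<close> all elements outside \<open>A\<close>: the successor of \<open>x \<in> A\<close> becomes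
  the next element of \<open>A\<close> that follows \<open>x\<close> on its cycle (\<open>x\<close> itself if there is no other).\<close>

definition delete_outside :: "('a \<Rightarrow> 'a) \<Rightarrow> 'a set \<Rightarrow> 'a \<Rightarrow> 'a" where
  "delete_outside p A x =
     (if x \<in> A then (p ^^ (LEAST n. 0 < n \<and> (p ^^ n) x \<in> A)) x else x)"


section \<open>Embeddings\<close>

text \<open>A 2-cell embedding on a closed orientable surface is represented by its triple
  \<open>(\<alpha>, \<beta>, \<gamma>)\<close> of permutations of the half edges, here the fields \<open>edge_perm\<close>, \<open>vertex_perm\<close>
  and \<open>face_perm\<close>. The fields \<open>vertex_of\<close> and \<open>edge_of\<close> tell which vertex (edge) of the graph
  a cycle of \<open>\<beta>\<close> (of \<open>\<alpha>\<close>) is.\<close>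

record ('v, 'e) embedding =
  edge_perm :: "nat \<Rightarrow> nat"
  vertex_perm :: "nat \<Rightarrow> nat"
  face_perm :: "nat \<Rightarrow> nat"
  vertex_of :: "nat set \<Rightarrow> 'v"
  edge_of :: "nat set \<Rightarrow> 'e"

definition half_edges :: "('v, 'e) multigraph \<Rightarrow> nat set" where
  "half_edges G = {1..2 * card (edges G)}"

definition is_embedding :: "('v, 'e) multigraph \<Rightarrow> ('v, 'e) embedding \<Rightarrow> bool" where
  "is_embedding G E \<longleftrightarrow>
     edge_perm E permutes half_edges G \<and>
     (\<forall>h \<in> half_edges G. edge_perm E h \<noteq> h \<and> edge_perm E (edge_perm E h) = h) \<and>
     vertex_perm E permutes half_edges G \<and>
     face_perm E = edge_perm E \<circ> vertex_perm E \<and>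
     bij_betw (vertex_of E) (cycles_of (vertex_perm E) (half_edges G)) (verts G) \<and>
     bij_betw (edge_of E) (cycles_of (edge_perm E) (half_edges G)) (edges G) \<and>
     (\<forall>h \<in> half_edges G.
        ends G (edge_of E (orbit (edge_perm E) h)) =
          Upair (vertex_of E (orbit (vertex_perm E) h))
                (vertex_of E (orbit (vertex_perm E) (edge_perm E h))))"

text \<open>The genus is the solution \<open>g\<close> of \<open>#vertices - #edges + #faces = 2 - 2 g\<close>. It is taken in
  the rationals so that this equation holds by definition, without first having to know that
  the Euler characteristic is even.\<close>

definition genus :: "('v, 'e) multigraph \<Rightarrow> ('v, 'e) embedding \<Rightarrow> rat" where
  "genus G E =
     (2 - (of_nat (card (cycles_of (vertex_perm E) (half_edges G)))
           - of_nat (card (cycles_of (edge_perm E) (half_edges G)))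
           + of_nat (card (cycles_of (face_perm E) (half_edges G))))) / 2"

text \<open>There are only finitely many triples of permutations of the half edges, so this is the
  minimum of a finite set.\<close>

definition min_genus :: "('v, 'e) multigraph \<Rightarrow> rat" where
  "min_genus G = Min {genus G E | E. is_embedding G E}"


section \<open>The local structure at a vertex\<close>

definition half_edges_at :: "('v, 'e) multigraph \<Rightarrow> ('v, 'e) embedding \<Rightarrow> 'v \<Rightarrow> nat set" where
  "half_edges_at G E v = {h \<in> half_edges G. vertex_of E (orbit (vertex_perm E) h) = v}"

definition vdeg :: "('v, 'e) multigraph \<Rightarrow> ('v, 'e) embedding \<Rightarrow> 'v \<Rightarrow> nat" where
  "vdeg G E v = card (half_edges_at G E v)"

definition num_faces_at :: "('v, 'e) multigraph \<Rightarrow> ('v, 'e) embedding \<Rightarrow> 'v \<Rightarrow> nat" where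
  "num_faces_at G E v =
     card {F \<in> cycles_of (face_perm E) (half_edges G). F \<inter> half_edges_at G E v \<noteq> {}}"

definition local_face_perm ::
  "('v, 'e) multigraph \<Rightarrow> ('v, 'e) embedding \<Rightarrow> 'v \<Rightarrow> nat \<Rightarrow> nat" where
  "local_face_perm G E v = delete_outside (face_perm E) (half_edges_at G E v)"

definition local_vertex_perm ::
  "('v, 'e) multigraph \<Rightarrow> ('v, 'e) embedding \<Rightarrow> 'v \<Rightarrow> nat \<Rightarrow> nat" where
  "local_vertex_perm G E v = perm_restrict (vertex_perm E) (half_edges_at G E v)"

definition local_D ::
  "('v, 'e) multigraph \<Rightarrow> ('v, 'e) embedding \<Rightarrow> 'v \<Rightarrow> nat \<Rightarrow> nat" where
  "local_D G E v = local_face_perm G E v \<circ> inv (local_vertex_perm G E v)"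

end

theory Submission
  imports Defs
begin

text \<open>
  Write \<open>c(p)\<close> for the number of cycles of \<open>p\<close> on \<open>H(v)\<close>, fixed points included, and
  \<open>d = deg(v)\<close>. Then \<open>s\<^sub>v = D\<^sub>v \<circ> \<pi>\<^sub>v\<close>, and \<open>q\<^sub>v = c(D\<^sub>v \<circ> \<pi>\<^sub>v)\<close>, because deleting half edges
  from the faces at \<open>v\<close> leaves one cycle for each of them (\<open>num_cycles_delete_outside\<close>).

  The point is that \<open>D\<^sub>v\<close> does not see the cyclic order at \<open>v\<close>. If the half edges at \<open>v\<close> are
  arranged in another cyclic order \<open>\<pi>'\<close>, the vertex permutation becomes \<open>\<beta> \<circ> t\<close> with
  \<open>t = \<pi>\<^sub>v\<inverse> \<circ> \<pi>'\<close>, the face permutation becomes \<open>s \<circ> t\<close>, and the new local face permutation is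
  \<open>s\<^sub>v \<circ> t = D\<^sub>v \<circ> \<pi>'\<close> (\<open>delete_outside_comp\<close>). The result is an embedding of the same graph
  (\<open>is_embedding_reembed\<close>), and the faces that avoid \<open>v\<close> are not affected. Hence, in an embedding
  of minimum genus, i.e. with the maximum number of faces, \<open>\<pi>\<^sub>v\<close> maximises \<open>c(D\<^sub>v \<circ> \<pi>')\<close> over all
  cyclic permutations \<open>\<pi>'\<close> of \<open>H(v)\<close>.

  It remains to see that this maximum is \<open>d + 1 - c(D)\<close> for every permutation \<open>D\<close> of a nonempty set
  of \<open>d\<close> elements. Both bounds rest on the fact that composing with a transposition \<open>(a b)\<close> merges
  two cycles or splits one, according to whether \<open>a\<close> and \<open>b\<close> lie in different cycles or in the same
  one. Splitting \<open>D\<close> into fixed points shows that \<open>D\<close> is a product of \<open>d - c(D)\<close> transpositions, so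
  that \<open>c(D \<circ> \<pi>') \<le> 1 + (d - c(D))\<close> (\<open>num_cycles_comp_le\<close>). Merging instead all cycles of \<open>D\<close> into
  one, by \<open>c(D) - 1\<close> transpositions, and taking for \<open>\<pi>'\<close> the inverse of that one cycle, makes
  \<open>D \<circ> \<pi>'\<close> a product of \<open>c(D) - 1\<close> transpositions, with at least \<open>d - (c(D) - 1)\<close> cycles
  (\<open>exists_cyclic_num_cycles_comp\<close>).
\<close>

section \<open>Counting the cycles of a permutation\<close>

definition num_cycles :: "('a \<Rightarrow> 'a) \<Rightarrow> 'a set \<Rightarrow> nat" where
  "num_cycles p S = card (cycles_of p S)"

lemma orbit_eq_of_mem:
  assumes "permutation p" "y \<in> orbit p x"
  shows "orbit p y = orbit p x"
  using cyclic_on_orbit'[OF assms(1), of x] assms(2) by (rule orbit_cyclic_eq3)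

lemma orbit_eq_iff_mem:
  assumes "permutation p"
  shows "orbit p y = orbit p x \<longleftrightarrow> y \<in> orbit p x"
  using orbit_eq_of_mem[OF assms] permutation_self_in_orbit[OF assms] by blast

lemma funpow_eq_of_agree:
  assumes "\<And>i. i < n \<Longrightarrow> q ((p ^^ i) x) = p ((p ^^ i) x)"
  shows "(q ^^ n) x = (p ^^ n) x"
  using assms by (induction n) auto

lemma first_return_exists:
  assumes "permutation p" "x \<in> A"
  obtains n where "0 < n" "(p ^^ n) x \<in> A" "\<And>m. 0 < m \<Longrightarrow> m < n \<Longrightarrow> (p ^^ m) x \<notin> A"
proof -
  have "x \<in> {(p ^^ k) x | k. 0 < k}"
    using permutation_self_in_orbit[OF assms(1), of x] unfolding orbit_altdef .
  then obtain k where "0 < k" "x = (p ^^ k) x" by blast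
  then have k: "0 < k \<and> (p ^^ k) x \<in> A" using assms(2) by metis
  define n where "n = (LEAST n. 0 < n \<and> (p ^^ n) x \<in> A)"
  have "0 < n \<and> (p ^^ n) x \<in> A" unfolding n_def using k by (rule LeastI)
  moreover have "(p ^^ m) x \<notin> A" if "0 < m" "m < n" for m
    using not_less_Least[of m "\<lambda>n. 0 < n \<and> (p ^^ n) x \<in> A"] that unfolding n_def by blast
  ultimately show ?thesis using that by blast
qed

text \<open>
  Starting at \<open>a\<close>, the new permutation follows the cycle of \<open>p\<close> until \<open>p\<close> would return to \<open>a\<close>;
  there the transposition diverts it to \<open>b\<close>.
\<close>

lemma transpose_comp_extends_orbit:
  assumes p: "permutation p" and b: "b \<notin> orbit p a"
  shows "insert b (orbit p a) \<subseteq> orbit (transpose a b \<circ> p) a"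
proof -
  let ?q = "transpose a b \<circ> p"
  have q: "permutation ?q" using p by (simp add: permutation_compose permutation_swap_id)
  obtain m where m: "0 < m" "(p ^^ m) a = a" "\<And>i. 0 < i \<Longrightarrow> i < m \<Longrightarrow> (p ^^ i) a \<noteq> a"
    using first_return_exists[OF p, of a "{a}"] by auto
  have nb: "(p ^^ i) a \<noteq> b" for i
    using b orbit_altdef_permutation[OF p, of a] by auto
  have agree: "(?q ^^ i) a = (p ^^ i) a" if "i < m" for i
  proof (rule funpow_eq_of_agree)
    fix j assume "j < i"
    then have "(p ^^ Suc j) a \<noteq> a" using m(3)[of "Suc j"] that by simp
    moreover have "(p ^^ Suc j) a \<noteq> b" by (rule nb)
    ultimately show "?q ((p ^^ j) a) = p ((p ^^ j) a)" by simp
  qed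
  have in_q: "(?q ^^ i) a \<in> orbit ?q a" for i
    using orbit_altdef_permutation[OF q, of a] by auto
  have "orbit p a \<subseteq> orbit ?q a"
    using orbit_altdef_bounded[OF m(2,1)] agree in_q by auto (metis)
  moreover have "(?q ^^ m) a = b"
  proof -
    have "(?q ^^ m) a = ?q ((?q ^^ (m - 1)) a)" using m(1) by (cases m) auto
    also have "\<dots> = transpose a b ((p ^^ m) a)" using m(1) agree[of "m - 1"] by (cases m) auto
    finally show ?thesis using m(2) by simp
  qed
  ultimately show ?thesis using in_q[of m] by auto
qed

text \<open>
  By the previous lemma the orbit of \<open>a\<close> reaches \<open>b\<close> after passing through its old cycle, and by
  symmetry the orbit of \<open>b\<close> passes through its own; the union is closed, since the transposition
  only exchanges two of its elements.
\<close>

lemma transpose_comp_merges: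
  assumes p: "permutation p" and b: "b \<notin> orbit p a"
  shows "orbit (transpose a b \<circ> p) a = orbit p a \<union> orbit p b"
proof
  let ?q = "transpose a b \<circ> p"
  have q: "permutation ?q" using p by (simp add: permutation_compose permutation_swap_id)
  have a: "a \<notin> orbit p b"
    using b orbit_eq_iff_mem[OF p] by blast
  have 1: "insert b (orbit p a) \<subseteq> orbit ?q a" using transpose_comp_extends_orbit[OF p b] .
  have 2: "insert a (orbit p b) \<subseteq> orbit ?q b"
    using transpose_comp_extends_orbit[OF p a] by (simp add: transpose_commute)
  show "orbit p a \<union> orbit p b \<subseteq> orbit ?q a"
    using 1 2 orbit_eq_of_mem[OF q, of b a] by blast
  show "orbit ?q a \<subseteq> orbit p a \<union> orbit p b"
  proof
    fix x assume "x \<in> orbit ?q a"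
    have st: "?q y \<in> orbit p a \<union> orbit p b" if "y \<in> orbit p a \<union> orbit p b" for y
      using that permutation_self_in_orbit[OF p] 
      by (auto simp: transpose_def intro: orbit.step)
    from \<open>x \<in> orbit ?q a\<close> show "x \<in> orbit p a \<union> orbit p b"
      by induction (use st permutation_self_in_orbit[OF p] in blast)+
  qed
qed

lemma num_cycles_merge:
  assumes p: "p permutes S" and fin: "finite S" and ab: "a \<in> S" "b \<in> S" and b: "b \<notin> orbit p a"
  shows "num_cycles p S = Suc (num_cycles (transpose a b \<circ> p) S)"
proof -
  let ?q = "transpose a b \<circ> p" and ?U = "orbit p a \<union> orbit p b"
  have pp: "permutation p" using p fin permutation_permutes by blast
  have q: "permutation ?q" using pp by (simp add: permutation_compose permutation_swap_id)
  note self = permutation_self_in_orbit[OF pp]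
  have U: "orbit ?q x = ?U" if "x \<in> ?U" for x
    using transpose_comp_merges[OF pp b] orbit_eq_of_mem[OF q, of x a] that by simp
  have off: "orbit ?q x = orbit p x" if "x \<notin> ?U" for x
  proof (rule orbit_cong[OF self])
    fix s assume "s \<in> orbit p x"
    then have "p s \<in> orbit p x" by (rule orbit.step)
    then have "p s \<noteq> a" "p s \<noteq> b" using that orbit_eq_iff_mem[OF pp] by blast+
    then show "?q s = p s" by simp
  qed
  have US: "?U \<subseteq> S" using permutes_orbit_subset[OF p] ab by blast
  define R where "R = orbit p ` (S - ?U)"
  have eqp: "cycles_of p S = insert (orbit p a) (insert (orbit p b) R)"
    unfolding cycles_of_def R_def using ab orbit_eq_of_mem[OF pp] by auto
  have eqq: "cycles_of ?q S = insert ?U R"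
  proof -
    have "cycles_of ?q S = orbit ?q ` ?U \<union> orbit ?q ` (S - ?U)"
      unfolding cycles_of_def using US by blast
    moreover have "orbit ?q ` ?U = {?U}" using U self by blast
    moreover have "orbit ?q ` (S - ?U) = R" unfolding R_def using off by (intro image_cong) auto
    ultimately show ?thesis by simp
  qed
  have "finite R" unfolding R_def using fin by simp
  moreover have "orbit p a \<notin> R" "orbit p b \<notin> R" "?U \<notin> R"
    unfolding R_def using self by auto
  moreover have "orbit p a \<noteq> orbit p b" using b self by blast
  ultimately show ?thesis unfolding num_cycles_def eqp eqq by simp
qed

text \<open>
  The cycle of \<open>a\<close> is closed up early: on the way from \<open>a\<close> to \<open>b\<close> along \<open>p\<close>, the last step is sent
  to \<open>a\<close> instead.
\<close>

lemma transpose_comp_splits: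
  assumes p: "permutation p" and b: "b \<in> orbit p a" and ne: "a \<noteq> b"
  shows "b \<notin> orbit (transpose a b \<circ> p) a"
proof -
  let ?q = "transpose a b \<circ> p"
  define n where "n = (LEAST n. (p ^^ n) a = b)"
  obtain k where "(p ^^ k) a = b" using b unfolding orbit_altdef by auto
  then have n: "(p ^^ n) a = b" unfolding n_def by (rule LeastI)
  have nb: "(p ^^ i) a \<noteq> b" if "i < n" for i
    using not_less_Least that unfolding n_def by blast
  have n0: "0 < n" using n ne by (cases n) auto
  \<comment> \<open>An earlier return to \<open>a\<close> would give an earlier arrival at \<open>b\<close>.\<close>
  have na: "(p ^^ i) a \<noteq> a" if "0 < i" "i < n" for i
  proof
    assume "(p ^^ i) a = a"
    then have "(p ^^ (n - i)) a = (p ^^ (n - i + i)) a" by (simp only: funpow_add comp_apply)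
    then have "(p ^^ (n - i)) a = b" using n that by simp
    then show False using nb[of "n - i"] that by simp
  qed
  have agree: "(?q ^^ i) a = (p ^^ i) a" if "i < n" for i
  proof (rule funpow_eq_of_agree)
    fix j assume "j < i"
    then have "(p ^^ Suc j) a \<noteq> a" "(p ^^ Suc j) a \<noteq> b"
      using na[of "Suc j"] nb[of "Suc j"] that by simp_all
    then show "?q ((p ^^ j) a) = p ((p ^^ j) a)" by simp
  qed
  have "(?q ^^ n) a = ?q ((?q ^^ (n - 1)) a)" using n0 by (cases n) auto
  also have "\<dots> = transpose a b ((p ^^ n) a)" using n0 agree[of "n - 1"] by (cases n) auto
  finally have "(?q ^^ n) a = a" using n by simp
  then have "orbit ?q a = {(?q ^^ i) a | i. i < n}" using n0 by (rule orbit_altdef_bounded)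
  then show ?thesis using agree nb by force
qed

text \<open>
  A transposition is an involution, so a split is a merge read backwards.
\<close>

lemma num_cycles_split:
  assumes p: "p permutes S" and fin: "finite S" and a: "a \<in> S"
    and b: "b \<in> orbit p a" and ne: "a \<noteq> b"
  shows "num_cycles (transpose a b \<circ> p) S = Suc (num_cycles p S)"
proof -
  have bS: "b \<in> S" using permutes_orbit_subset[OF p a] b by blast
  have "permutation p" using p fin permutation_permutes by blast
  then have "b \<notin> orbit (transpose a b \<circ> p) a" using b ne by (rule transpose_comp_splits)
  moreover have "transpose a b \<circ> p permutes S"
    using p a bS by (intro permutes_compose permutes_swap_id)
  moreover have "transpose a b \<circ> (transpose a b \<circ> p) = p" by (simp add: fun_eq_iff)
  ultimately show ?thesis using num_cycles_merge[of "transpose a b \<circ> p" S a b] fin a bS by simp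
qed

lemma num_cycles_transpose_le:
  assumes p: "p permutes S" and fin: "finite S" and "a \<in> S" "b \<in> S"
  shows "num_cycles (transpose a b \<circ> p) S \<le> Suc (num_cycles p S)"
    and "num_cycles p S \<le> Suc (num_cycles (transpose a b \<circ> p) S)"
proof -
  consider "a = b" | "a \<noteq> b" "b \<in> orbit p a" | "b \<notin> orbit p a" by blast
  then have "num_cycles (transpose a b \<circ> p) S \<le> Suc (num_cycles p S) \<and>
    num_cycles p S \<le> Suc (num_cycles (transpose a b \<circ> p) S)"
  proof cases
    case 1
    then show ?thesis by simp
  next
    case 2
    then show ?thesis using num_cycles_split[OF p fin assms(3)] by simp
  next
    case 3
    then show ?thesis using num_cycles_merge[OF p fin assms(3,4)] by simp
  qed
  then show "num_cycles (transpose a b \<circ> p) S \<le> Suc (num_cycles p S)"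
    and "num_cycles p S \<le> Suc (num_cycles (transpose a b \<circ> p) S)" by auto
qed

lemma num_cycles_le_card:
  assumes "finite S"
  shows "num_cycles p S \<le> card S"
  unfolding num_cycles_def cycles_of_def using assms by (rule card_image_le)

lemma num_cycles_id: "num_cycles id S = card S"
proof -
  have "orbit id x = {x}" for x :: 'a by (simp add: orbit_eq_singleton_iff)
  then have "cycles_of id S = (\<lambda>x. {x}) ` S" unfolding cycles_of_def by simp
  then show ?thesis unfolding num_cycles_def by (simp add: card_image)
qed

lemma num_cycles_cyclic:
  assumes "cyclic_on p S"
  shows "num_cycles p S = 1"
proof -
  have "cycles_of p S = {S}"
    using assms unfolding cycles_of_def cyclic_on_alldef by auto
  then show ?thesis by (simp add: num_cycles_def)
qed

text \<open>
  A permutation \<open>D\<close> of \<open>S\<close> is a product of \<open>card S - num_cycles D S\<close> transpositions, each of which adds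
  at most one cycle to \<open>p\<close>. The induction detaches the transpositions one by one: as long as \<open>D\<close> moves
  some \<open>a\<close>, composing with \<open>(a D(a))\<close> splits the cycle of \<open>a\<close>.
\<close>

lemma num_cycles_comp_le:
  assumes "D permutes S" "p permutes S" "finite S"
  shows "num_cycles (D \<circ> p) S + num_cycles D S \<le> num_cycles p S + card S"
  using assms(1)
proof (induction "card S - num_cycles D S" arbitrary: D rule: less_induct)
  case less
  show ?case
  proof (cases "D = id")
    case True
    then show ?thesis by (simp add: num_cycles_id)
  next
    case False
    then obtain a where a: "D a \<noteq> a" by (auto simp: fun_eq_iff)
    then have aS: "a \<in> S" using less.prems permutes_not_in by metis
    have bS: "D a \<in> S" using less.prems aS by (simp add: permutes_in_image)
    define T where "T = transpose a (D a)"
    define D' where "D' = T \<circ> D"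
    have D': "D' permutes S"
      unfolding D'_def T_def using less.prems aS bS by (intro permutes_compose permutes_swap_id)
    have c: "num_cycles D' S = Suc (num_cycles D S)"
      unfolding D'_def T_def using less.prems assms(3) aS a
      by (intro num_cycles_split) (auto intro: orbit.base)
    have le: "num_cycles D' S \<le> card S" using assms(3) by (rule num_cycles_le_card)
    have "num_cycles (D' \<circ> p) S + num_cycles D' S \<le> num_cycles p S + card S"
      using less.hyps[OF _ D'] c le by linarith
    moreover have "D \<circ> p = T \<circ> (D' \<circ> p)" by (simp add: fun_eq_iff D'_def T_def)
    moreover have "num_cycles (T \<circ> (D' \<circ> p)) S \<le> Suc (num_cycles (D' \<circ> p) S)"
      unfolding T_def using D' assms aS bS by (intro num_cycles_transpose_le(1) permutes_compose)
    ultimately show ?thesis using c by simp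
  qed
qed

text \<open>
  For a cyclic \<open>D\<close> the inverse of \<open>D\<close> will do, as the composite is then the identity. Otherwise two
  cycles of \<open>D\<close> are merged by a transposition, and a \<open>p\<close> that serves the merged permutation also serves
  \<open>D\<close>: the term \<open>num_cycles D S\<close> exceeds that of the merged permutation by one, which pays for the at most one
  cycle that the transposition takes away from the composite.
\<close>

lemma exists_cyclic_num_cycles_comp:
  assumes "D permutes S" "finite S" "S \<noteq> {}"
  shows "\<exists>p. p permutes S \<and> cyclic_on p S \<and> card S + 1 \<le> num_cycles (D \<circ> p) S + num_cycles D S"
  using assms(1)
proof (induction "num_cycles D S" arbitrary: D rule: less_induct)
  case less
  have perm: "permutation D" using less.prems assms(2) permutation_permutes by blast
  show ?case
  proof (cases "\<exists>a\<in>S. \<exists>b\<in>S. b \<notin> orbit D a")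
    case True
    then obtain a b where ab: "a \<in> S" "b \<in> S" "b \<notin> orbit D a" by blast
    define T where "T = transpose a b"
    have c: "num_cycles D S = Suc (num_cycles (T \<circ> D) S)"
      unfolding T_def using less.prems assms(2) ab by (rule num_cycles_merge)
    have TD: "T \<circ> D permutes S"
      unfolding T_def using less.prems ab by (intro permutes_compose permutes_swap_id)
    obtain p where p: "p permutes S" "cyclic_on p S"
      "card S + 1 \<le> num_cycles (T \<circ> D \<circ> p) S + num_cycles (T \<circ> D) S"
      using less.hyps[OF _ TD] c by auto
    have "num_cycles (T \<circ> (D \<circ> p)) S \<le> Suc (num_cycles (D \<circ> p) S)"
      unfolding T_def using less.prems p ab assms(2)
      by (intro num_cycles_transpose_le(1) permutes_compose)
    then show ?thesis using p c by (auto simp: comp_assoc)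
  next
    case False
    have cyc: "cyclic_on D S"
      using False permutes_orbit_subset[OF less.prems] assms(3) unfolding cyclic_on_alldef by blast
    then have "cyclic_on (inv D) S" using orbit_inv_eq[OF perm] unfolding cyclic_on_def by simp
    moreover have "D \<circ> inv D = id" using less.prems by (rule permutes_inv_o)
    ultimately show ?thesis
      using permutes_inv[OF less.prems] num_cycles_id[of S] num_cycles_cyclic[OF cyc] by auto
  qed
qed

section \<open>Deleting elements from the cycles of a permutation\<close>

lemma delete_outside_eq_funpow:
  assumes "x \<in> A" "0 < n" "(p ^^ n) x \<in> A" "\<And>m. 0 < m \<Longrightarrow> m < n \<Longrightarrow> (p ^^ m) x \<notin> A"
  shows "delete_outside p A x = (p ^^ n) x"
proof -
  have "(LEAST n. 0 < n \<and> (p ^^ n) x \<in> A) = n"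
    using assms by (intro Least_equality) (auto simp: not_less[symmetric])
  then show ?thesis using assms(1) by (simp add: delete_outside_def)
qed

lemma delete_outside_in_orbit:
  assumes "permutation p" "x \<in> A"
  shows "delete_outside p A x \<in> orbit p x \<inter> A"
  by (rule first_return_exists[OF assms])
    (use assms(2) in \<open>auto simp: delete_outside_eq_funpow orbit_altdef\<close>)

lemma orbit_delete_outside:
  assumes p: "permutation p" and x: "x \<in> A"
  shows "orbit (delete_outside p A) x = orbit p x \<inter> A"
proof
  let ?d = "delete_outside p A"
  show "orbit ?d x \<subseteq> orbit p x \<inter> A"
  proof
    fix y assume "y \<in> orbit ?d x"
    then show "y \<in> orbit p x \<inter> A"
    proof induction
      case base
      show ?case using delete_outside_in_orbit[OF p x] .
    next
      case (step y)
      then show ?case using delete_outside_in_orbit[OF p, of y A] by (auto intro: orbit_trans)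
    qed
  qed
  have "(p ^^ k) x \<in> orbit ?d x" if "0 < k" "(p ^^ k) x \<in> A" for k
    using x that
  proof (induction k arbitrary: x rule: less_induct)
    case (less k)
    obtain n where n: "0 < n" "(p ^^ n) x \<in> A" "\<And>m. 0 < m \<Longrightarrow> m < n \<Longrightarrow> (p ^^ m) x \<notin> A"
      using first_return_exists[OF p less.prems(1)] by blast
    have d: "?d x = (p ^^ n) x" using less.prems(1) n by (rule delete_outside_eq_funpow)
    have "n \<le> k" using n(3)[of k] less.prems by (meson not_less)
    show ?case
    proof (cases "n = k")
      case True
      then show ?thesis using orbit.base[of ?d x] d by simp
    next
      case False
      have s: "(p ^^ (k - n)) ((p ^^ n) x) = (p ^^ k) x"
        using \<open>n \<le> k\<close> funpow_add[of "k - n" n p] by (simp add: fun_eq_iff)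
      have "(p ^^ k) x \<in> orbit ?d (?d x)"
        using less.IH[of "k - n" "?d x"] False \<open>n \<le> k\<close> n less.prems d s by simp
      then show ?thesis by (rule orbit_subset)
    qed
  qed
  then show "orbit p x \<inter> A \<subseteq> orbit ?d x" by (auto simp: orbit_altdef[of p])
qed

lemma delete_outside_permutes:
  assumes p: "permutation p" and fin: "finite A"
  shows "delete_outside p A permutes A"
proof -
  let ?d = "delete_outside p A"
  have "?d ` A = A"
  proof
    show "?d ` A \<subseteq> A" using delete_outside_in_orbit[OF p] by blast
    show "A \<subseteq> ?d ` A"
    proof
      fix x assume x: "x \<in> A"
      have "orbit ?d x \<subseteq> A" using orbit_delete_outside[OF p x] by blast
      moreover have "x \<in> orbit ?d x"
        using orbit_delete_outside[OF p x] permutation_self_in_orbit[OF p] x by blast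
      ultimately show "x \<in> ?d ` A" using x by (metis image_eqI orbit.cases subsetD)
    qed
  qed
  then have "bij_betw ?d A A"
    using fin by (simp add: bij_betw_def finite_surj_inj)
  then show ?thesis by (rule bij_imp_permutes) (simp add: delete_outside_def)
qed

text \<open>
  Deletion turns a cycle \<open>F\<close> of \<open>p\<close> that meets \<open>A\<close> into the single cycle \<open>F \<inter> A\<close>.
\<close>

lemma num_cycles_delete_outside:
  assumes p: "p permutes S" and fin: "finite S" and A: "A \<subseteq> S"
  shows "num_cycles (delete_outside p A) A = card {F \<in> cycles_of p S. F \<inter> A \<noteq> {}}"
proof -
  have pp: "permutation p" using p fin permutation_permutes by blast
  let ?M = "{F \<in> cycles_of p S. F \<inter> A \<noteq> {}}"
  have M: "?M = orbit p ` A"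
    unfolding cycles_of_def using A orbit_eq_of_mem[OF pp] permutation_self_in_orbit[OF pp] by blast
  have "cycles_of (delete_outside p A) A = (\<lambda>F. F \<inter> A) ` ?M"
    unfolding M unfolding cycles_of_def image_image
    using orbit_delete_outside[OF pp] by (intro image_cong) auto
  moreover have "inj_on (\<lambda>F. F \<inter> A) ?M"
  proof (rule inj_onI)
    fix F F' assume F: "F \<in> ?M" and F': "F' \<in> ?M" and eq: "F \<inter> A = F' \<inter> A"
    then obtain x where "x \<in> F" "x \<in> F'" by blast
    then have "orbit p x = F" "orbit p x = F'"
      using F F' orbit_eq_of_mem[OF pp] unfolding M by blast+
    then show "F = F'" by simp
  qed
  ultimately show ?thesis unfolding num_cycles_def by (simp add: card_image)
qed

text \<open>
  As \<open>t\<close> moves only elements of \<open>A\<close>, on the way from \<open>x \<in> A\<close> back to \<open>A\<close> the iterates of \<open>p \<circ> t\<close>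
  can differ from those of \<open>p\<close> only in the first step, which starts at \<open>t x\<close>.
\<close>

lemma delete_outside_comp:
  assumes p: "permutation p" and t: "t permutes A"
  shows "delete_outside (p \<circ> t) A = delete_outside p A \<circ> t"
proof
  fix x
  show "delete_outside (p \<circ> t) A x = (delete_outside p A \<circ> t) x"
  proof (cases "x \<in> A")
    case True
    then have tx: "t x \<in> A" using t by (simp add: permutes_in_image)
    obtain n where n: "0 < n" "(p ^^ n) (t x) \<in> A"
      "\<And>m. 0 < m \<Longrightarrow> m < n \<Longrightarrow> (p ^^ m) (t x) \<notin> A"
      using first_return_exists[OF p tx] by blast
    have eq: "((p \<circ> t) ^^ m) x = (p ^^ m) (t x)" if "0 < m" "m \<le> n" for m
      using that
    proof (induction m)
      case (Suc m)
      then show ?case using n(3)[of m] permutes_not_in[OF t] by (cases "m = 0") auto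
    qed simp
    have "delete_outside (p \<circ> t) A x = ((p \<circ> t) ^^ n) x"
      using True n eq by (intro delete_outside_eq_funpow) auto
    moreover have "delete_outside p A (t x) = (p ^^ n) (t x)"
      using tx n by (rule delete_outside_eq_funpow)
    ultimately show ?thesis using eq[of n] n(1) by simp
  next
    case False
    then show ?thesis using permutes_not_in[OF t False] by (simp add: delete_outside_def)
  qed
qed

section \<open>Re-embedding the neighbourhood of one vertex\<close>

lemma cycles_avoiding_subset_cycles_comp:
  assumes p: "permutation p" and t: "t permutes A"
  shows "{F \<in> cycles_of p S. F \<inter> A = {}} \<subseteq> {F \<in> cycles_of (p \<circ> t) S. F \<inter> A = {}}"
proof -
  have "orbit (p \<circ> t) x = orbit p x" if "orbit p x \<inter> A = {}" for x
  proof (rule orbit_cong[OF permutation_self_in_orbit[OF p]])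
    fix y assume "y \<in> orbit p x"
    then have "y \<notin> A" using that by blast
    then show "(p \<circ> t) y = p y" using permutes_not_in[OF t] by simp
  qed
  then show ?thesis unfolding cycles_of_def by (auto intro!: image_eqI[where f = "orbit (p \<circ> t)"])
qed

lemma num_cycles_eq_meeting_plus_avoiding:
  assumes "finite S"
  shows "num_cycles p S = card {F \<in> cycles_of p S. F \<inter> A \<noteq> {}} + card {F \<in> cycles_of p S. F \<inter> A = {}}"
proof -
  have "finite (cycles_of p S)" using assms by (simp add: cycles_of_def)
  moreover have "cycles_of p S = {F \<in> cycles_of p S. F \<inter> A \<noteq> {}} \<union> {F \<in> cycles_of p S. F \<inter> A = {}}"
    by blast
  ultimately show ?thesis unfolding num_cycles_def
    by (subst card_Un_disjoint[symmetric]) auto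
qed

text \<open>
  Rearranging the cyclic order at one vertex changes no vertex as a set of half edges. Equality of the
  orbits lets the vertex labels \<open>vertex_of\<close> be kept.
\<close>

lemma orbit_replace_cycle:
  assumes b: "permutation b" and A: "cyclic_on b A" and t: "t permutes A"
    and bt: "cyclic_on (b \<circ> t) A"
  shows "orbit (b \<circ> t) = orbit b"
proof
  fix x
  show "orbit (b \<circ> t) x = orbit b x"
  proof (cases "x \<in> A")
    case True
    then show ?thesis using A bt by (simp add: orbit_cyclic_eq3)
  next
    case False
    have "s \<notin> A" if "s \<in> orbit b x" for s
      using that False A orbit_eq_of_mem[OF b that] orbit_cyclic_eq3[OF A, of s]
        permutation_self_in_orbit[OF b, of x] by blast
    then show ?thesis
      using permutes_not_in[OF t] by (intro orbit_cong[OF permutation_self_in_orbit[OF b]]) simp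
  qed
qed

text \<open>
  Since the face permutation is \<open>\<alpha> \<circ> \<beta>\<close>, replacing \<open>\<beta>\<close> by \<open>\<beta> \<circ> t\<close> composes it with \<open>t\<close> as well.
\<close>

definition reembed ::
  "('v, 'e) embedding \<Rightarrow> (nat \<Rightarrow> nat) \<Rightarrow> ('v, 'e) embedding" where
  "reembed E t = E\<lparr>vertex_perm := vertex_perm E \<circ> t, face_perm := face_perm E \<circ> t\<rparr>"

lemma is_embedding_reembed:
  assumes E: "is_embedding G E" and A: "cyclic_on (vertex_perm E) A" "A \<subseteq> half_edges G"
    and t: "t permutes A" and cyc: "cyclic_on (vertex_perm E \<circ> t) A"
  shows "is_embedding G (reembed E t)"
proof -
  have b: "vertex_perm E permutes half_edges G" using E by (simp add: is_embedding_def)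
  then have perm: "permutation (vertex_perm E)"
    using permutation_permutes[of "vertex_perm E"] by (auto simp: half_edges_def)
  have bt: "vertex_perm E \<circ> t permutes half_edges G"
    using b t A(2) by (intro permutes_compose) (auto intro: permutes_subset)
  have "orbit (vertex_perm E \<circ> t) = orbit (vertex_perm E)"
    using perm A(1) t cyc by (rule orbit_replace_cycle)
  then show ?thesis using E bt
    unfolding is_embedding_def reembed_def cycles_of_def by (simp add: comp_assoc)
qed

text \<open>
  The minimum over a set is meaningful only if the set is finite. The genera are determined by three cycle
  counts, each at most the number of half edges.
\<close>

lemma min_genus_le:
  assumes "is_embedding G E"
  shows "min_genus G \<le> genus G E"
proof -
  let ?H = "half_edges G"
  let ?f = "\<lambda>(a, b, c). (2 - (rat_of_nat a - of_nat b + of_nat c)) / 2"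
  have le: "card (cycles_of p ?H) \<le> card ?H" for p
    unfolding cycles_of_def by (rule card_image_le) (simp add: half_edges_def)
  have "genus G E' \<in> ?f ` ({..card ?H} \<times> {..card ?H} \<times> {..card ?H})" for E' :: "('a, 'b) embedding"
    unfolding genus_def by (rule image_eqI[where x = "(_, _, _)"]) (auto simp: le)
  then have "{genus G E' | E'. is_embedding G E'} \<subseteq> ?f ` ({..card ?H} \<times> {..card ?H} \<times> {..card ?H})"
    by blast
  then have "finite {genus G E' | E'. is_embedding G E'}"
    by (rule finite_subset) simp
  then show ?thesis unfolding min_genus_def using assms by (intro Min_le) auto
qed

lemma cyclic_on_half_edges_at:
  assumes E: "is_embedding G E" and v: "v \<in> verts G"
  shows "cyclic_on (vertex_perm E) (half_edges_at G E v)"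
proof -
  let ?b = "vertex_perm E" and ?H = "half_edges G"
  have b: "?b permutes ?H" using E by (simp add: is_embedding_def)
  then have perm: "permutation ?b" using permutation_permutes[of ?b] by (auto simp: half_edges_def)
  have bij: "bij_betw (vertex_of E) (cycles_of ?b ?H) (verts G)"
    using E by (simp add: is_embedding_def)
  have "v \<in> vertex_of E ` orbit ?b ` ?H"
    using bij_betw_imp_surj_on[OF bij] v by (simp add: cycles_of_def)
  then obtain h where h: "h \<in> ?H" "vertex_of E (orbit ?b h) = v" by (elim imageE) simp
  have "half_edges_at G E v = orbit ?b h"
  proof
    show "half_edges_at G E v \<subseteq> orbit ?b h"
    proof
      fix x assume "x \<in> half_edges_at G E v"
      then have x: "x \<in> ?H" "vertex_of E (orbit ?b x) = v" by (auto simp: half_edges_at_def)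
      have "orbit ?b x = orbit ?b h"
        using bij_betw_imp_inj_on[OF bij] by (rule inj_onD) (use x h in \<open>auto simp: cycles_of_def\<close>)
      then show "x \<in> orbit ?b h" using permutation_self_in_orbit[OF perm, of x] by simp
    qed
    show "orbit ?b h \<subseteq> half_edges_at G E v"
      using permutes_orbit_subset[OF b h(1)] orbit_eq_of_mem[OF perm] h(2)
      by (auto simp: half_edges_at_def)
  qed
  then show ?thesis using cyclic_on_orbit'[OF perm] by simp
qed

text \<open>
  The embedding and the rearranged one have equally many vertices and edges, so by Euler's
  formula the one of minimum genus has at least as many faces.
\<close>

lemma num_faces_reembed_le:
  assumes E: "is_embedding G E" and min: "genus G E = min_genus G"
    and A: "cyclic_on (vertex_perm E) A" "A \<subseteq> half_edges G"
    and t: "t permutes A" and cyc: "cyclic_on (vertex_perm E \<circ> t) A"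
  shows "num_cycles (face_perm E \<circ> t) (half_edges G) \<le> num_cycles (face_perm E) (half_edges G)"
proof -
  have "genus G E \<le> genus G (reembed E t)"
    using min_genus_le[OF is_embedding_reembed[OF E A t cyc]] min by simp
  moreover have "permutation (vertex_perm E)"
    using E permutation_permutes[of "vertex_perm E"] by (auto simp: half_edges_def is_embedding_def)
  then have "orbit (vertex_perm E \<circ> t) = orbit (vertex_perm E)"
    using A(1) t cyc by (rule orbit_replace_cycle)
  ultimately show ?thesis
    by (simp add: genus_def reembed_def num_cycles_def cycles_of_def)
qed

theorem corollary4p9:
  fixes G :: "('v, 'e) multigraph" and E :: "('v, 'e) embedding" and v :: 'v
  assumes "finite_connected_multigraph G"
    and "is_embedding G E"
    and "genus G E = min_genus G"
    and "v \<in> verts G"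
  shows "size (cycle_type (local_D G E v) (half_edges_at G E v)) + num_faces_at G E v
           = vdeg G E v + 1"
proof -
  define H where "H = half_edges G"
  define A where "A = half_edges_at G E v"
  define s where "s = face_perm E"
  define b where "b = vertex_perm E"
  define sv where "sv = delete_outside s A"
  define bv where "bv = perm_restrict b A"
  define D where "D = sv \<circ> inv bv"
  have finH: "finite H" by (simp add: H_def half_edges_def)
  have AH: "A \<subseteq> H" by (auto simp: A_def H_def half_edges_at_def)
  then have finA: "finite A" using finH finite_subset by blast
  have bH: "b permutes H" and sH: "s permutes H"
    using assms(2) by (auto simp: is_embedding_def b_def s_def H_def intro: permutes_compose)
  then have perm_s: "permutation s" using finH permutation_permutes by blast
  have cyc: "cyclic_on b A" unfolding b_def A_def using assms(2,4) by (rule cyclic_on_half_edges_at)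
  then have neA: "A \<noteq> {}" by (auto simp: cyclic_on_def)
  have bvA: "bv permutes A"
  proof (rule bij_imp_permutes)
    have "bv ` A \<subseteq> A" using cyclic_on_inI[OF cyc] by (auto simp: bv_def perm_restrict_def)
    moreover have "inj_on bv A"
      using permutes_inj[OF bH] by (auto simp: bv_def perm_restrict_def inj_on_def)
    ultimately show "bij_betw bv A A" using finA by (simp add: bij_betw_def endo_inj_surj)
  qed (simp add: bv_def perm_restrict_def)
  have cyc_bv: "cyclic_on bv A" using cyc by (simp add: bv_def cyclic_on_perm_restrict)
  have svA: "sv permutes A" unfolding sv_def using perm_s finA by (rule delete_outside_permutes)
  have DA: "D permutes A" unfolding D_def using svA permutes_inv[OF bvA] by (intro permutes_compose)
  have sv: "sv = D \<circ> bv"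
    using permutes_inv_o(2)[OF bvA] by (simp add: D_def comp_assoc)
  have q: "num_faces_at G E v = num_cycles sv A"
    unfolding num_faces_at_def sv_def using num_cycles_delete_outside[OF sH finH AH]
    by (simp add: s_def H_def A_def)
  have D: "size (cycle_type (local_D G E v) (half_edges_at G E v)) = num_cycles D A"
    by (simp add: cycle_type_def num_cycles_def local_D_def local_face_perm_def
        local_vertex_perm_def D_def sv_def bv_def s_def b_def A_def)
  have upper: "num_cycles sv A + num_cycles D A \<le> card A + 1"
    using num_cycles_comp_le[OF DA bvA finA] num_cycles_cyclic[OF cyc_bv] sv by simp

  \<comment> \<open>Rearranging the half edges at \<open>v\<close> in the optimal cyclic order \<open>p\<close>.\<close>
  obtain p where p: "p permutes A" "cyclic_on p A"
    "card A + 1 \<le> num_cycles (D \<circ> p) A + num_cycles D A"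
    using exists_cyclic_num_cycles_comp[OF DA finA neA] by blast
  define t where "t = inv bv \<circ> p"
  have t: "t permutes A" unfolding t_def using p(1) permutes_inv[OF bvA] by (intro permutes_compose)
  have bt: "(b \<circ> t) x = p x" if "x \<in> A" for x
  proof -
    have "t x \<in> A" using t that by (simp add: permutes_in_image)
    then have "b (t x) = bv (t x)" by (simp add: bv_def perm_restrict_def)
    then show ?thesis using permutes_inverses(1)[OF bvA] by (simp add: t_def)
  qed
  have cyc_bt: "cyclic_on (b \<circ> t) A" using p(2) cyclic_cong[of A "b \<circ> t" p] bt by blast
  have del: "delete_outside (s \<circ> t) A = D \<circ> p"
    using delete_outside_comp[OF perm_s t] by (simp add: D_def t_def sv_def comp_assoc)
  have stH: "s \<circ> t permutes H" using sH t AH by (intro permutes_compose) (auto intro: permutes_subset)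
  have "num_cycles (s \<circ> t) H \<le> num_cycles s H"
    using num_faces_reembed_le[OF assms(2,3)] cyc AH t cyc_bt by (simp add: b_def s_def H_def)
  moreover have "card {F \<in> cycles_of s H. F \<inter> A = {}} \<le> card {F \<in> cycles_of (s \<circ> t) H. F \<inter> A = {}}"
    using cycles_avoiding_subset_cycles_comp[OF perm_s t] finH by (intro card_mono) (auto simp: cycles_of_def)
  moreover have "num_cycles s H = num_cycles sv A + card {F \<in> cycles_of s H. F \<inter> A = {}}"
    unfolding sv_def num_cycles_delete_outside[OF sH finH AH]
    using finH by (rule num_cycles_eq_meeting_plus_avoiding)
  moreover have "num_cycles (s \<circ> t) H = num_cycles (D \<circ> p) A + card {F \<in> cycles_of (s \<circ> t) H. F \<inter> A = {}}"
    unfolding del[symmetric] num_cycles_delete_outside[OF stH finH AH]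
    using finH by (rule num_cycles_eq_meeting_plus_avoiding)
  ultimately have "num_cycles (D \<circ> p) A \<le> num_cycles sv A" by linarith
  then have "num_cycles D A + num_cycles sv A = card A + 1" using upper p(3) by linarith
  then show ?thesis unfolding D q by (simp add: vdeg_def A_def)
qed

end
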